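(* Let $(X,d)$ and $(Y,d_Y)$ be compact metric spaces and let $\mathbb S$ be the free semigroup action induced on $(X,d)$ by a family of continuous maps $(g_y\colon X\to X)_{y\in Y}$. Then for every Borel probability measure $\mathbb P$ on $Y^{\mathbb N}$, $$\overline{\mathrm{mdim}}_M\big(X,\mathbb S,d,\mathbb P\big)=\limsup_{\varepsilon\to0^+}\frac{\sup_{x\in X}h_d(x,\varepsilon)}{-\log\varepsilon}.$$
   Context: Setting. $(X,d)$ and $(Y,d_Y)$ are compact metric spaces and $(g_y)_{y\in Y}$ is a family of continuous maps $g_y\colon X\to X$. $G$ is the free semigroup generated by $G_1=\{g_y: y\in Y\}$ under composition, and $\mathbb S\colon G\times X\to X$, $(g,x)\mapsto g(x)$, is the induced action. Elements of $G$ are treated as words (concatenations) in the generators. Standing assumptions: the skew product $T_G\colon Y^{\mathbb N}\times X\to Y^{\mathbb N}\times X$, $T_G(\omega,x)=(\sigma(\omega),g_{\omega_1}(x))$, with $\omega=(\omega_1,\omega_2,\dots)$ and $\sigma$ the one-sided shift, is continuous; and $G_1$ is minimal, i.e. no $g_y$ is a composition of the remaining generators. Dynamical metric. For a word $\underline g=g_{\omega_n}\cdots g_{\omega_1}$ put $\underline g_0=\mathrm{id}$, $\underline g_j=g_{\omega_j}\cdots g_{\omega_1}$ and $d_{\underline g}(x,z)=\max_{0\le j\le n}d(\underline g_j(x),\underline g_j(z))$. A set $E\subset X$ is $(\underline g,n,\varepsilon)$-separated if $d_{\underline g}(x,z)>\varepsilon$ for all distinct $x,z\in E$; $s(\underline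 g,n,\varepsilon)$ is the largest cardinality of a $(\underline g,n,\varepsilon)$-separated subset of $X$. Metric mean dimension. $h(X,\mathbb S,\mathbb P,\varepsilon)=\limsup_{n\to\infty}\frac1n\log\int_{Y^{\mathbb N}}s(g_{\omega_n}\cdots g_{\omega_1},n,\varepsilon)\,d\mathbb P(\omega)$ and $\overline{\mathrm{mdim}}_M(X,\mathbb S,d,\mathbb P)=\limsup_{\varepsilon\to0^+}\frac{h(X,\mathbb S,\mathbb P,\varepsilon)}{-\log\varepsilon}$. Local entropy. For a compact $K\subset X$ let $b(K,g_{\omega_n}\cdots g_{\omega_1},\varepsilon)$ be the minimum cardinality of a set $A\subset X$ such that every $x\in K$ satisfies $d_{\underline g}(x,a)\le\varepsilon$ for some $a\in A$, where $\underline g=g_{\omega_n}\cdots g_{\omega_1}$. Put $B(K,\mathbb S,\varepsilon)=\limsup_{n\to\infty}\frac1n\log\int_{Y^{\mathbb N}}b(K,g_{\omega_n}\cdots g_{\omega_1},\varepsilon)\,d\mathbb P(\omega)$ and, for $x\in X$, $h_d(x,\varepsilon)=\inf\{B(K,\mathbb S,\varepsilon): K\text{ is a compact neighbourhood of }x\}$ (this depends on $\mathbb P$). *)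

theory Defs
  imports "HOL-Probability.Probability"
begin

text \<open>
  A point of \<open>Y\<^sup>\<nat>\<close> is a function \<open>\<omega> :: nat \<Rightarrow> 'y\<close>, carrying the product topology; the
  letter written \<open>\<omega>\<^sub>k\<close> (\<open>k \<ge> 1\<close>) on paper is \<open>\<omega> (k - 1)\<close> here.

  An element of the free semigroup is a word, i.e. a list of indices in order of application:
  the list \<open>[\<omega>\<^sub>1, \<dots>, \<omega>\<^sub>n]\<close> stands for \<open>g\<^bsub>\<omega>\<^sub>n\<^esub> \<circ> \<dots> \<circ> g\<^bsub>\<omega>\<^sub>1\<^esub>\<close>.
\<close>

definition word_action :: "('y \<Rightarrow> 'x \<Rightarrow> 'x) \<Rightarrow> 'y list \<Rightarrow> 'x \<Rightarrow> 'x" where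
  "word_action g w x = fold g w x"

definition word_prefix :: "nat \<Rightarrow> (nat \<Rightarrow> 'y) \<Rightarrow> 'y list" where
  "word_prefix n \<omega> = map \<omega> [0..<n]"

definition skew_product ::
  "('y \<Rightarrow> 'x \<Rightarrow> 'x) \<Rightarrow> (nat \<Rightarrow> 'y) \<times> 'x \<Rightarrow> (nat \<Rightarrow> 'y) \<times> 'x" where
  "skew_product g = (\<lambda>(\<omega>, x). (\<lambda>n. \<omega> (Suc n), g (\<omega> 0) x))"

text \<open>
  Semigroup elements are compositions of at least one generator, so the empty composition
  is not admitted: the identity may itself be one of the generators.
\<close>

definition minimal_generators :: "('x \<Rightarrow> 'x) set \<Rightarrow> bool" where
  "minimal_generators G1 \<longleftrightarrow>
     (\<forall>f\<in>G1. \<not> (\<exists>fs. fs \<noteq> [] \<and> set fs \<subseteq> G1 - {f} \<and> foldr (\<circ>) fs id = f))"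

definition dyn_dist :: "('y \<Rightarrow> 'x::metric_space \<Rightarrow> 'x) \<Rightarrow> 'y list \<Rightarrow> 'x \<Rightarrow> 'x \<Rightarrow> real" where
  "dyn_dist g w x z =
     Max ((\<lambda>j. dist (word_action g (take j w) x) (word_action g (take j w) z)) ` {0..length w})"

definition separated_set :: "('y \<Rightarrow> 'x::metric_space \<Rightarrow> 'x) \<Rightarrow> 'y list \<Rightarrow> real \<Rightarrow> 'x set \<Rightarrow> bool" where
  "separated_set g w \<epsilon> E \<longleftrightarrow> (\<forall>x\<in>E. \<forall>z\<in>E. x \<noteq> z \<longrightarrow> dyn_dist g w x z > \<epsilon>)"

text \<open>
  The length \<open>n\<close> in \<open>s(g, n, \<epsilon>)\<close> is the length of the word and is not repeated as an argument.
  Cardinalities are taken in \<^typ>\<open>ennreal\<close>, so that the supremum, and the infimum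
  in \<open>covering_number\<close>, need no finiteness side conditions; every subset of a separated set is
  separated, so restricting to finite sets does not change the supremum.
\<close>

definition separation_number :: "('y \<Rightarrow> 'x::metric_space \<Rightarrow> 'x) \<Rightarrow> 'y list \<Rightarrow> real \<Rightarrow> ennreal" where
  "separation_number g w \<epsilon> = (SUP E\<in>{E. finite E \<and> separated_set g w \<epsilon> E}. of_nat (card E))"

definition covering_number ::
  "('y \<Rightarrow> 'x::metric_space \<Rightarrow> 'x) \<Rightarrow> 'x set \<Rightarrow> 'y list \<Rightarrow> real \<Rightarrow> ennreal" where
  "covering_number g K w \<epsilon> =
     (INF A\<in>{A. finite A \<and> (\<forall>x\<in>K. \<exists>a\<in>A. dyn_dist g w x a \<le> \<epsilon>)}. of_nat (card A))"

definition log_ennreal :: "ennreal \<Rightarrow> ereal" where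
  "log_ennreal t =
     (if t = 0 then -\<infinity> else if t = \<top> then \<infinity> else ereal (ln (enn2real t)))"

definition growth_rate :: "(nat \<Rightarrow> 'y) measure \<Rightarrow> ('y list \<Rightarrow> ennreal) \<Rightarrow> ereal" where
  "growth_rate P c =
     limsup (\<lambda>n. ereal (1 / real n) * log_ennreal (\<integral>\<^sup>+ \<omega>. c (word_prefix n \<omega>) \<partial>P))"

definition entropy_scale ::
  "('y \<Rightarrow> 'x::metric_space \<Rightarrow> 'x) \<Rightarrow> (nat \<Rightarrow> 'y) measure \<Rightarrow> real \<Rightarrow> ereal" where
  "entropy_scale g P \<epsilon> = growth_rate P (\<lambda>w. separation_number g w \<epsilon>)"

definition upper_metric_mean_dimension ::
  "('y \<Rightarrow> 'x::metric_space \<Rightarrow> 'x) \<Rightarrow> (nat \<Rightarrow> 'y) measure \<Rightarrow> ereal" where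
  "upper_metric_mean_dimension g P =
     Limsup (at_right 0) (\<lambda>\<epsilon>. entropy_scale g P \<epsilon> / ereal (- ln \<epsilon>))"

definition covering_entropy ::
  "('y \<Rightarrow> 'x::metric_space \<Rightarrow> 'x) \<Rightarrow> (nat \<Rightarrow> 'y) measure \<Rightarrow> 'x set \<Rightarrow> real \<Rightarrow> ereal" where
  "covering_entropy g P K \<epsilon> = growth_rate P (\<lambda>w. covering_number g K w \<epsilon>)"

definition local_entropy ::
  "('y \<Rightarrow> 'x::metric_space \<Rightarrow> 'x) \<Rightarrow> (nat \<Rightarrow> 'y) measure \<Rightarrow> 'x \<Rightarrow> real \<Rightarrow> ereal" where
  "local_entropy g P x \<epsilon> =
     (INF K\<in>{K. compact K \<and> x \<in> interior K}. covering_entropy g P K \<epsilon>)"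

end

theory Submission
  imports Defs "HOL-Real_Asymp.Real_Asymp"
begin

text \<open>
  Covering and separation numbers satisfy \<open>s(2\<epsilon>) \<le> b(X, \<epsilon>) \<le> s(\<epsilon>)\<close>, and
  rescaling \<open>\<epsilon>\<close> by a constant does not affect the quotient by \<open>-log \<epsilon>\<close> in the
  limit; so the metric mean dimension may be computed from \<open>B(X, \<epsilon>)\<close>. At each fixed scale,
  \<open>B(X, \<epsilon>)\<close> is the supremum of the local entropies: cover \<open>X\<close> by finitely many compact
  neighbourhoods and use that the growth rate of a finite sum is the largest growth rate.
  The latter needs additivity of the integral, hence measurability of the covering numbers,
  which are lower semicontinuous in \<open>\<omega>\<close> because \<open>X\<close> is compact.
\<close>

section \<open>Words and dynamical metrics\<close>

lemma length_word_prefix [simp]: "length (word_prefix n \<omega>) = n"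
  by (simp add: word_prefix_def)

lemma take_word_prefix: "j \<le> n \<Longrightarrow> take j (word_prefix n \<omega>) = word_prefix j \<omega>"
  by (simp add: word_prefix_def take_map)

lemma dyn_dist_le_iff:
  "dyn_dist g w x z \<le> \<epsilon> \<longleftrightarrow>
     (\<forall>j\<le>length w. dist (word_action g (take j w) x) (word_action g (take j w) z) \<le> \<epsilon>)"
  unfolding dyn_dist_def by (subst Max_le_iff) auto

lemma dyn_dist_commute: "dyn_dist g w x z = dyn_dist g w z x"
  by (simp add: dyn_dist_def dist_commute)

lemma dyn_dist_triangle: "dyn_dist g w x z \<le> dyn_dist g w x y + dyn_dist g w y z"
proof -
  let ?u = "\<lambda>j. word_action g (take j w)"
  have "dist (?u j x) (?u j z) \<le> dyn_dist g w x y + dyn_dist g w y z" if "j \<le> length w" for j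
  proof -
    have "dist (?u j x) (?u j y) \<le> dyn_dist g w x y" "dist (?u j y) (?u j z) \<le> dyn_dist g w y z"
      using that dyn_dist_le_iff by blast+
    then show ?thesis
      using dist_triangle[of "?u j x" "?u j z" "?u j y"] by linarith
  qed
  then show ?thesis
    by (simp add: dyn_dist_le_iff)
qed

lemma dyn_dist_self [simp]: "dyn_dist g w x x = 0"
proof -
  have "(\<lambda>j. dist (word_action g (take j w) x) (word_action g (take j w) x)) ` {0..length w} = {0}"
    by auto
  then show ?thesis
    by (simp add: dyn_dist_def)
qed

text \<open>Lets the continuity of \<open>skew_product g\<close> pass to all words, jointly in the
  letters and the point.\<close>

lemma word_action_prefix_skew_product:
  "word_action g (word_prefix n \<omega>) x = snd ((skew_product g ^^ n) (\<omega>, x))"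
proof -
  \<comment> \<open>The induction has to carry the shifted sequence too: its entry at 0 is the
    letter applied next.\<close>
  have "(skew_product g ^^ n) (\<omega>, x) = (\<lambda>k. \<omega> (k + n), fold g (word_prefix n \<omega>) x)"
    by (induction n) (auto simp: skew_product_def word_prefix_def)
  then show ?thesis
    by (simp add: word_action_def)
qed

lemma continuous_on_word_action:
  assumes "continuous_on UNIV (skew_product g)"
  shows "continuous_on UNIV (\<lambda>(\<omega>, x). word_action g (word_prefix n \<omega>) x)"
proof -
  have "continuous_on UNIV (skew_product g ^^ n)"
  proof (induction n)
    case (Suc n)
    then show ?case
      using continuous_on_compose[OF Suc continuous_on_subset[OF assms subset_UNIV]]
      by (simp add: o_def)
  qed (simp add: id_def)
  then show ?thesis
    by (simp add: word_action_prefix_skew_product case_prod_beta continuous_on_snd)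
qed

section \<open>Covering and separation numbers\<close>

definition dyn_cover :: "('y \<Rightarrow> 'x::metric_space \<Rightarrow> 'x) \<Rightarrow> 'x set \<Rightarrow> 'y list \<Rightarrow> real \<Rightarrow> 'x set \<Rightarrow> bool"
  where "dyn_cover g K w \<epsilon> A \<longleftrightarrow> finite A \<and> (\<forall>x\<in>K. \<exists>a\<in>A. dyn_dist g w x a \<le> \<epsilon>)"

lemma covering_number_eq_INF:
  "covering_number g K w \<epsilon> = (INF A\<in>Collect (dyn_cover g K w \<epsilon>). of_nat (card A))"
proof -
  have "Collect (dyn_cover g K w \<epsilon>) = {A. finite A \<and> (\<forall>x\<in>K. \<exists>a\<in>A. dyn_dist g w x a \<le> \<epsilon>)}"
    by (auto simp: dyn_cover_def)
  then show ?thesis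
    by (simp add: covering_number_def)
qed

lemma covering_number_le: "dyn_cover g K w \<epsilon> A \<Longrightarrow> covering_number g K w \<epsilon> \<le> of_nat (card A)"
  unfolding covering_number_eq_INF by (rule INF_lower) auto

text \<open>An infimum of natural numbers over a nonempty family is a minimum; the empty family
  would give the value top.\<close>

lemma covering_number_attained:
  assumes "covering_number g K w \<epsilon> \<noteq> \<top>"
  obtains A where "dyn_cover g K w \<epsilon> A" "covering_number g K w \<epsilon> = of_nat (card A)"
proof -
  obtain A0 where "dyn_cover g K w \<epsilon> A0"
    using assms unfolding covering_number_eq_INF by fastforce
  then obtain A where A: "dyn_cover g K w \<epsilon> A"
    and min: "\<And>B. dyn_cover g K w \<epsilon> B \<Longrightarrow> card A \<le> card B"
    by (metis ex_has_least_nat)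
  have "covering_number g K w \<epsilon> = of_nat (card A)"
    using A min covering_number_le unfolding covering_number_eq_INF
    by (intro antisym INF_lower INF_greatest) auto
  then show thesis
    using A that by blast
qed

lemma covering_number_empty [simp]: "covering_number g {} w \<epsilon> = 0"
  using covering_number_le[of g "{}" w \<epsilon> "{}"] by (simp add: dyn_cover_def)

lemma covering_number_Un_le:
  "covering_number g (K \<union> L) w \<epsilon> \<le> covering_number g K w \<epsilon> + covering_number g L w \<epsilon>"
proof (cases "covering_number g K w \<epsilon> = \<top> \<or> covering_number g L w \<epsilon> = \<top>")
  case False
  then obtain A B where A: "dyn_cover g K w \<epsilon> A" "covering_number g K w \<epsilon> = of_nat (card A)"
    and B: "dyn_cover g L w \<epsilon> B" "covering_number g L w \<epsilon> = of_nat (card B)"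
    by (meson covering_number_attained)
  have "dyn_cover g (K \<union> L) w \<epsilon> (A \<union> B)"
    using A B by (auto simp: dyn_cover_def)
  then have "covering_number g (K \<union> L) w \<epsilon> \<le> of_nat (card (A \<union> B))"
    by (rule covering_number_le)
  also have "\<dots> \<le> of_nat (card A + card B)"
    by (simp add: card_Un_le del: of_nat_add)
  finally show ?thesis
    by (simp add: A B)
qed auto

lemma covering_number_UN_le:
  assumes "finite I"
  shows "covering_number g (\<Union>i\<in>I. K i) w \<epsilon> \<le> (\<Sum>i\<in>I. covering_number g (K i) w \<epsilon>)"
  using assms
proof (induction I rule: finite_induct)
  case (insert i I)
  have "covering_number g (\<Union>i\<in>insert i I. K i) w \<epsilon>
          \<le> covering_number g (K i) w \<epsilon> + covering_number g (\<Union>i\<in>I. K i) w \<epsilon>"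
    using covering_number_Un_le by simp
  also have "\<dots> \<le> covering_number g (K i) w \<epsilon> + (\<Sum>i\<in>I. covering_number g (K i) w \<epsilon>)"
    by (intro add_left_mono insert.IH)
  finally show ?case
    using insert by simp
qed simp

text \<open>Two points served by the same centre are at distance at most twice \<epsilon>, so
  sending each separated point to a centre is injective.\<close>

lemma separation_number_le_covering_number:
  "separation_number g w (2 * \<epsilon>) \<le> covering_number g UNIV w \<epsilon>"
  unfolding separation_number_def covering_number_eq_INF
proof (rule SUP_least, rule INF_greatest, clarsimp)
  fix E A
  assume E: "finite E" "separated_set g w (2 * \<epsilon>) E" and A: "dyn_cover g UNIV w \<epsilon> A"
  then obtain f where f: "\<And>x. f x \<in> A" "\<And>x. dyn_dist g w x (f x) \<le> \<epsilon>"
    unfolding dyn_cover_def by (metis UNIV_I)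
  have "inj_on f E"
  proof (rule inj_onI, rule ccontr)
    fix x z assume *: "x \<in> E" "z \<in> E" "f x = f z" "x \<noteq> z"
    have "dyn_dist g w x z \<le> 2 * \<epsilon>"
      using dyn_dist_triangle[of g w x z "f x"] f(2)[of x] f(2)[of z] *(3)
      by (simp add: dyn_dist_commute)
    then show False
      using E(2) * by (force simp: separated_set_def)
  qed
  then show "card E \<le> card A"
    using A f(1) by (intro card_inj_on_le[of f]) (auto simp: dyn_cover_def)
qed

text \<open>A separated set of maximal cardinality is a cover.\<close>

lemma covering_number_le_separation_number:
  assumes "\<epsilon> \<ge> 0"
  shows "covering_number g UNIV w \<epsilon> \<le> separation_number g w \<epsilon>"
proof (cases "separation_number g w \<epsilon> = \<top>")
  case False
  let ?S = "\<lambda>E. finite E \<and> separated_set g w \<epsilon> E"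
  have upper: "of_nat (card E) \<le> separation_number g w \<epsilon>" if "?S E" for E
    unfolding separation_number_def using that by (intro SUP_upper) auto
  \<comment> \<open>A finite supremum bounds all cardinalities by one natural number, so a largest
    separated set exists.\<close>
  obtain m where m: "separation_number g w \<epsilon> < of_nat m"
    using False ennreal_Ex_less_of_nat less_top by blast
  have "card E < m" if "?S E" for E
    using le_less_trans[OF upper[OF that] m] by simp
  moreover have "?S {}"
    by (simp add: separated_set_def)
  ultimately obtain E where E: "?S E" and max: "\<And>F. ?S F \<Longrightarrow> card F \<le> card E"
    using ex_has_greatest_nat[of ?S "{}" card m] by metis
  have "\<exists>a\<in>E. dyn_dist g w x a \<le> \<epsilon>" for x
  proof (rule ccontr)
    assume "\<not> ?thesis"
    then have far: "dyn_dist g w x a > \<epsilon>" "dyn_dist g w a x > \<epsilon>" if "a \<in> E" for a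
      using that dyn_dist_commute[of g w a x] by force+
    then have "?S (insert x E)"
      using E by (auto simp: separated_set_def)
    then have "card (insert x E) \<le> card E"
      by (rule max)
    \<comment> \<open>Otherwise \<open>far\<close> would make the distance from \<open>x\<close> to
      itself exceed \<epsilon>, against \<epsilon> \<ge> 0.\<close>
    moreover have "x \<notin> E"
      using far assms by fastforce
    ultimately show False
      using E by simp
  qed
  then have "dyn_cover g UNIV w \<epsilon> E"
    using E by (simp add: dyn_cover_def)
  then show ?thesis
    using covering_number_le upper[OF E] order_trans by blast
qed simp

section \<open>Measurability\<close>

text \<open>Prepares measurability: the infimum becomes countable, and the centres become a point of
  the product space of sequences, of which only the first \<open>k\<close> entries matter. Entries
  may repeat, so \<open>k\<close> only bounds the number of centres.\<close>

lemma covering_number_eq_INF_nat: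
  "covering_number g K w \<epsilon> =
     (INF k. if \<exists>a. \<forall>x\<in>K. \<exists>i<k. dyn_dist g w x (a i) \<le> \<epsilon> then of_nat k else \<top>)"
    (is "_ = (INF k. if ?C k then _ else _)")
proof (rule antisym)
  show "covering_number g K w \<epsilon> \<le> (INF k. if ?C k then of_nat k else \<top>)"
  proof (rule INF_greatest)
    fix k
    have "covering_number g K w \<epsilon> \<le> of_nat k" if C: "?C k"
    proof -
      obtain a where a: "\<forall>x\<in>K. \<exists>i<k. dyn_dist g w x (a i) \<le> \<epsilon>"
        using C by blast
      then have "dyn_cover g K w \<epsilon> (a ` {..<k})"
        by (auto simp: dyn_cover_def)
      then have "covering_number g K w \<epsilon> \<le> of_nat (card (a ` {..<k}))"
        by (rule covering_number_le)
      also have "\<dots> \<le> of_nat k"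
        using card_image_le[of "{..<k}" a] by simp
      finally show ?thesis .
    qed
    then show "covering_number g K w \<epsilon> \<le> (if ?C k then of_nat k else \<top>)"
      by simp
  qed
  show "(INF k. if ?C k then of_nat k else \<top>) \<le> covering_number g K w \<epsilon>"
    unfolding covering_number_eq_INF
  proof (rule INF_greatest)
    fix A assume "A \<in> Collect (dyn_cover g K w \<epsilon>)"
    then have A: "dyn_cover g K w \<epsilon> A"
      by simp
    then obtain a where a: "bij_betw a {..<card A} A"
      using ex_bij_betw_nat_finite unfolding dyn_cover_def lessThan_atLeast0 by metis
    have "\<exists>i<card A. dyn_dist g w x (a i) \<le> \<epsilon>" if "x \<in> K" for x
      using A that bij_betw_imp_surj_on[OF a] unfolding dyn_cover_def by (metis imageE lessThan_iff)
    then have C: "?C (card A)"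
      by blast
    have "(INF k. if ?C k then of_nat k else \<top>) \<le> (if ?C (card A) then of_nat (card A) else \<top> :: ennreal)"
      by (rule INF_lower) simp
    then show "(INF k. if ?C k then of_nat k else \<top>) \<le> (of_nat (card A) :: ennreal)"
      using C by simp
  qed
qed

lemma compact_UNIV_fun:
  assumes "compact (UNIV :: 'x::topological_space set)"
  shows "compact (UNIV :: ('i \<Rightarrow> 'x) set)"
proof -
  have "compact_space (product_topology (\<lambda>_::'i. euclidean :: 'x topology) UNIV)"
    using assms by (subst compact_space_product_topology) (simp add: compact_space_def)
  then show ?thesis
    by (simp add: euclidean_product_topology compact_space_def)
qed

text \<open>One closed condition for each time up to \<open>n\<close>. The map \<open>u\<close>
  extracts the centre from the parameter; later it is a coordinate of a sequence of centres.\<close>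

lemma closed_dyn_dist_le:
  fixes u :: "'b::topological_space \<Rightarrow> 'x::metric_space"
  assumes "continuous_on UNIV (skew_product g)"
    and "continuous_on UNIV u"
  shows "closed {(\<omega>, a). dyn_dist g (word_prefix n \<omega>) x (u a) \<le> \<epsilon>}"
proof -
  \<comment> \<open>Stated for general \<open>v\<close> to serve both the moving centre
    \<open>u\<close> and the constant point \<open>x\<close>.\<close>
  have cont: "continuous_on UNIV (\<lambda>p. word_action g (word_prefix j (fst p)) (v (snd p)))"
    if "continuous_on UNIV v" for v :: "'b \<Rightarrow> 'x" and j
  proof -
    have "continuous_on UNIV ((\<lambda>(\<omega>, x). word_action g (word_prefix j \<omega>) x) \<circ> (\<lambda>p. (fst p, v (snd p))))"
      by (intro continuous_on_compose continuous_on_Pair continuous_on_fst continuous_on_id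
          continuous_on_compose2[OF that continuous_on_snd[OF continuous_on_id]]
          continuous_on_subset[OF continuous_on_word_action[OF assms(1)]]) auto
    then show ?thesis
      by (simp add: o_def)
  qed
  have eq: "{(\<omega>, a). dyn_dist g (word_prefix n \<omega>) x (u a) \<le> \<epsilon>} =
      (\<Inter>j\<in>{..n}. {p. dist (word_action g (word_prefix j (fst p)) x)
                      (word_action g (word_prefix j (fst p)) (u (snd p))) \<le> \<epsilon>})"
    by (auto simp: dyn_dist_le_iff take_word_prefix)
  show ?thesis
    unfolding eq
    by (intro closed_INT ballI closed_Collect_le continuous_on_dist cont assms(2)
        cont[of "\<lambda>_. x"] continuous_on_const)
qed

text \<open>The sequences \<omega> for which \<open>k\<close> centres suffice form the projection of
  a closed set along a compact factor, hence a closed set.\<close>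

lemma borel_measurable_covering_number:
  fixes g :: "'y::topological_space \<Rightarrow> 'x::metric_space \<Rightarrow> 'x"
  assumes cpt: "compact (UNIV :: 'x set)"
    and cont: "continuous_on UNIV (skew_product g)"
  shows "(\<lambda>\<omega>. covering_number g K (word_prefix n \<omega>) \<epsilon>) \<in> borel_measurable borel"
proof -
  let ?R = "\<lambda>k. {(\<omega>, a :: nat \<Rightarrow> 'x). \<forall>x\<in>K. \<exists>i<k. dyn_dist g (word_prefix n \<omega>) x (a i) \<le> \<epsilon>}"
  have "closed {\<omega>. \<exists>a. \<forall>x\<in>K. \<exists>i<k. dyn_dist g (word_prefix n \<omega>) x (a i) \<le> \<epsilon>}" for k :: nat
  proof -
    \<comment> \<open>The union is finite and the intersection arbitrary, so closedness survives
      even for uncountable \<open>K\<close>.\<close>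
    have R: "?R k = (\<Inter>x\<in>K. \<Union>i<k. {(\<omega>, a :: nat \<Rightarrow> 'x). dyn_dist g (word_prefix n \<omega>) x (a i) \<le> \<epsilon>})"
      by auto
    have "closed (?R k)"
      unfolding R by (intro closed_INT ballI closed_UN closed_dyn_dist_le cont) auto
    moreover have "closed_map (prod_topology euclidean euclidean) euclidean
        (fst :: (nat \<Rightarrow> 'y) \<times> (nat \<Rightarrow> 'x) \<Rightarrow> _)"
      using compact_UNIV_fun[OF cpt]
      by (intro Abstract_Topological_Spaces.closed_map_fst) (simp add: compact_space_def)
    ultimately have "closed (fst ` ?R k)"
      by (simp add: closed_map_def)
    moreover have "fst ` ?R k = {\<omega>. \<exists>a. \<forall>x\<in>K. \<exists>i<k. dyn_dist g (word_prefix n \<omega>) x (a i) \<le> \<epsilon>}"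
      by force
    ultimately show ?thesis
      by simp
  qed
  then show ?thesis
    unfolding covering_number_eq_INF_nat
    by (intro borel_measurable_INF measurable_If_set measurable_If) (auto simp: borel_closed)
qed

section \<open>Growth rates\<close>

lemma log_ennreal_le_iff: "log_ennreal t \<le> ereal a \<longleftrightarrow> t \<le> ennreal (exp a)"
proof (cases t)
  case (real r)
  have "ln r \<le> a \<longleftrightarrow> r \<le> exp a" if "r > 0"
    using that by (metis exp_le_cancel_iff exp_ln)
  then show ?thesis
    using real by (cases "r = 0") (auto simp: log_ennreal_def)
qed (simp add: log_ennreal_def top_unique)

lemma log_ennreal_mono:
  assumes "s \<le> t"
  shows "log_ennreal s \<le> log_ennreal t"
proof (rule ereal_le_real)
  show "log_ennreal s \<le> ereal a" if "log_ennreal t \<le> ereal a" for a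
    using that assms by (auto simp: log_ennreal_le_iff intro: order_trans)
qed

lemma growth_rate_mono:
  assumes "\<And>w. c w \<le> c' w"
  shows "growth_rate P c \<le> growth_rate P c'"
  unfolding growth_rate_def
  by (intro Limsup_mono always_eventually allI ereal_mult_left_mono log_ennreal_mono
      nn_integral_mono assms) simp

text \<open>Turns bounds on rates into bounds on integrals. For \<open>n = 0\<close> the factor is 0
  by convention and the equivalence can fail.\<close>

lemma inverse_times_log_ennreal_le_iff:
  assumes "n > 0"
  shows "ereal (1 / real n) * log_ennreal t \<le> ereal c \<longleftrightarrow> t \<le> ennreal (exp (real n * c))"
proof -
  have "ereal (1 / real n) * log_ennreal t \<le> ereal c \<longleftrightarrow> log_ennreal t \<le> ereal (real n * c)"
    using assms by (cases "log_ennreal t") (auto simp: field_simps)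
  then show ?thesis
    by (simp add: log_ennreal_le_iff)
qed

lemma Limsup_le_of_tendsto:
  assumes "eventually (\<lambda>x. f x \<le> ereal (u x)) F" and "(u \<longlongrightarrow> c) F" and "F \<noteq> bot"
  shows "Limsup F f \<le> ereal c"
  using Limsup_mono[OF assms(1)] lim_imp_Limsup[OF assms(3), of "\<lambda>x. ereal (u x)" "ereal c"] assms(2)
  by simp

text \<open>Eventually every integral is at most exp(n b), so their sum is at most card I times
  that; the constant costs only (ln m)/n in the rate. The strict bound by \<open>b\<close> is what
  makes the estimates hold eventually.\<close>

lemma growth_rate_sum_le:
  assumes "finite I"
    and "\<And>i n. i \<in> I \<Longrightarrow> (\<lambda>\<omega>. c i (word_prefix n \<omega>)) \<in> borel_measurable P"
    and "\<And>i. i \<in> I \<Longrightarrow> growth_rate P (c i) < ereal b"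
  shows "growth_rate P (\<lambda>w. \<Sum>i\<in>I. c i w) \<le> ereal b"
  unfolding growth_rate_def
proof (rule Limsup_le_of_tendsto)
  \<comment> \<open>The added 1 keeps \<open>m\<close> positive, so that exp(ln m) = m also for
    empty \<open>I\<close>.\<close>
  define m where "m = real (card I) + 1"
  have "eventually (\<lambda>n. ereal (1 / real n) * log_ennreal (\<integral>\<^sup>+ \<omega>. c i (word_prefix n \<omega>) \<partial>P) < ereal b)
          sequentially" if "i \<in> I" for i
    using assms(3)[OF that] unfolding growth_rate_def by (rule Limsup_lessD)
  then have "eventually (\<lambda>n. \<forall>i\<in>I. ereal (1 / real n) *
      log_ennreal (\<integral>\<^sup>+ \<omega>. c i (word_prefix n \<omega>) \<partial>P) < ereal b) sequentially"
    using assms(1) by (simp add: eventually_ball_finite)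
  then show "eventually (\<lambda>n. ereal (1 / real n) *
      log_ennreal (\<integral>\<^sup>+ \<omega>. (\<Sum>i\<in>I. c i (word_prefix n \<omega>)) \<partial>P) \<le> ereal (b + ln m / real n)) sequentially"
    using eventually_gt_at_top[of "0::nat"]
  proof eventually_elim
    case (elim n)
    have le: "(\<integral>\<^sup>+ \<omega>. c i (word_prefix n \<omega>) \<partial>P) \<le> ennreal (exp (real n * b))" if "i \<in> I" for i
      using elim that by (simp add: less_imp_le flip: inverse_times_log_ennreal_le_iff)
    \<comment> \<open>Additivity of the integral is where measurability enters.\<close>
    have "(\<integral>\<^sup>+ \<omega>. (\<Sum>i\<in>I. c i (word_prefix n \<omega>)) \<partial>P) = (\<Sum>i\<in>I. \<integral>\<^sup>+ \<omega>. c i (word_prefix n \<omega>) \<partial>P)"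
      using assms(2) by (rule nn_integral_sum)
    also have "\<dots> \<le> (\<Sum>i\<in>I. ennreal (exp (real n * b)))"
      by (intro sum_mono le)
    also have "\<dots> = ennreal (real (card I) * exp (real n * b))"
      by (simp add: ennreal_mult' ennreal_of_nat_eq_real_of_nat)
    also have "\<dots> \<le> ennreal (m * exp (real n * b))"
      by (intro ennreal_leI mult_right_mono) (auto simp: m_def)
    also have "m * exp (real n * b) = exp (real n * (b + ln m / real n))"
      using elim by (simp add: exp_add m_def algebra_simps)
    finally show ?case
      using elim by (subst inverse_times_log_ennreal_le_iff) auto
  qed
  show "((\<lambda>n. b + ln m / real n) \<longlongrightarrow> b) sequentially"
    using tendsto_add[OF tendsto_const lim_const_over_n[of "ln m"], of b] by simp
qed simp

section \<open>Local entropies and the covering entropy of the whole space\<close>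

lemma covering_entropy_UNIV_le:
  fixes g :: "'y::metric_space \<Rightarrow> 'x::metric_space \<Rightarrow> 'x"
  assumes cpt: "compact (UNIV :: 'x set)"
    and cont: "continuous_on UNIV (skew_product g)"
    and sets: "sets P = sets borel"
    and less: "\<And>x. local_entropy g P x \<epsilon> < ereal b"
  shows "covering_entropy g P UNIV \<epsilon> \<le> ereal b"
proof -
  have "\<exists>K. x \<in> interior K \<and> covering_entropy g P K \<epsilon> < ereal b" for x
    using less[of x] by (auto simp: local_entropy_def INF_less_iff)
  then obtain K where K: "\<And>x. x \<in> interior (K x)"
    and ent: "\<And>x. covering_entropy g P (K x) \<epsilon> < ereal b"
    by metis
  obtain D where D: "finite D" "UNIV \<subseteq> (\<Union>x\<in>D. interior (K x))"
    by (rule compactE_image[OF cpt, of UNIV "\<lambda>x. interior (K x)"]) (use K in blast)+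
  then have UN: "(\<Union>x\<in>D. K x) = UNIV"
    using interior_subset by blast
  have "covering_entropy g P UNIV \<epsilon> \<le> growth_rate P (\<lambda>w. \<Sum>x\<in>D. covering_number g (K x) w \<epsilon>)"
    unfolding covering_entropy_def
    using covering_number_UN_le[OF D(1), of g K] by (intro growth_rate_mono) (simp add: UN)
  also have "\<dots> \<le> ereal b"
  proof (rule growth_rate_sum_le[OF D(1)])
    show "(\<lambda>\<omega>. covering_number g (K x) (word_prefix n \<omega>) \<epsilon>) \<in> borel_measurable P" for x n
      using borel_measurable_covering_number[OF cpt cont] sets
      by (simp add: measurable_cong_sets[OF sets refl])
    show "growth_rate P (\<lambda>w. covering_number g (K x) w \<epsilon>) < ereal b" for x
      using ent[of x] by (simp add: covering_entropy_def)
  qed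
  finally show ?thesis .
qed

lemma SUP_local_entropy:
  fixes g :: "'y::metric_space \<Rightarrow> 'x::metric_space \<Rightarrow> 'x"
  assumes cpt: "compact (UNIV :: 'x set)"
    and cont: "continuous_on UNIV (skew_product g)"
    and sets: "sets P = sets borel"
  shows "(SUP x. local_entropy g P x \<epsilon>) = covering_entropy g P UNIV \<epsilon>"
proof (rule antisym)
  \<comment> \<open>The whole space is itself a compact neighbourhood of every point.\<close>
  show "(SUP x. local_entropy g P x \<epsilon>) \<le> covering_entropy g P UNIV \<epsilon>"
    unfolding local_entropy_def using cpt by (intro SUP_least INF_lower) auto
  show "covering_entropy g P UNIV \<epsilon> \<le> (SUP x. local_entropy g P x \<epsilon>)"
  \<comment> \<open>Testing against all \<open>b\<close> strictly above the supremum gives each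
    local entropy the strict bound needed to choose neighbourhoods.\<close>
  proof (rule dense_ge)
    fix b assume b: "(SUP x. local_entropy g P x \<epsilon>) < b"
    have "local_entropy g P x \<epsilon> < b" for x
      using le_less_trans[OF SUP_upper[OF UNIV_I] b] .
    then show "covering_entropy g P UNIV \<epsilon> \<le> b"
      using covering_entropy_UNIV_le[OF cpt cont sets] by (cases b) auto
  qed
qed

section \<open>Rescaling\<close>

text \<open>Halving the scale adds only ln 2 to the denominator, and the ratio of the two
  denominators tends to 1.\<close>

lemma Limsup_scale_divide_ln_le:
  fixes F G :: "real \<Rightarrow> ereal"
  assumes le: "\<And>\<epsilon>. \<epsilon> > 0 \<Longrightarrow> F (2 * \<epsilon>) \<le> G \<epsilon>"
  shows "Limsup (at_right 0) (\<lambda>\<epsilon>. F \<epsilon> / ereal (- ln \<epsilon>))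
           \<le> Limsup (at_right 0) (\<lambda>\<epsilon>. G \<epsilon> / ereal (- ln \<epsilon>))" (is "_ \<le> ?L")
proof (rule dense_ge)
  fix c assume c: "?L < c"
  show "Limsup (at_right 0) (\<lambda>\<epsilon>. F \<epsilon> / ereal (- ln \<epsilon>)) \<le> c"
  proof (cases c)
    case (real r)
    have half: "filterlim (\<lambda>\<epsilon>::real. \<epsilon> / 2) (at_right 0) (at_right 0)"
      by real_asymp
    have "eventually (\<lambda>\<epsilon>. G \<epsilon> / ereal (- ln \<epsilon>) < ereal r) (at_right 0)"
      using Limsup_lessD[OF c] real by simp
    from eventually_compose_filterlim[OF this half]
    have "eventually (\<lambda>\<epsilon>. G (\<epsilon> / 2) / ereal (- ln (\<epsilon> / 2)) < ereal r) (at_right 0)" .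
    \<comment> \<open>Below scale 1 both denominators are positive, so multiplying and dividing by
      them preserves inequalities.\<close>
    moreover have "eventually (\<lambda>\<epsilon>::real. \<epsilon> \<in> {0<..<1}) (at_right 0)"
      by (rule eventually_at_right_real) simp
    ultimately have "eventually (\<lambda>\<epsilon>. F \<epsilon> / ereal (- ln \<epsilon>) \<le> ereal (r * (- ln (\<epsilon> / 2)) / (- ln \<epsilon>))) (at_right 0)"
    proof eventually_elim
      case (elim \<epsilon>)
      then have pos: "- ln \<epsilon> > 0" "- ln (\<epsilon> / 2) > 0"
        by (auto simp: ln_div)
      have "F \<epsilon> \<le> G (\<epsilon> / 2)"
        using le[of "\<epsilon> / 2"] elim by simp
      also have "\<dots> \<le> ereal (r * (- ln (\<epsilon> / 2)))"
        using elim pos by (subst (asm) ereal_divide_less_iff) (auto simp: less_imp_le)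
      finally have "F \<epsilon> / ereal (- ln \<epsilon>) \<le> ereal (r * (- ln (\<epsilon> / 2))) / ereal (- ln \<epsilon>)"
        using pos by (intro ereal_divide_right_mono) auto
      then show ?case
        using pos by simp
    qed
    moreover have "((\<lambda>\<epsilon>. r * (- ln (\<epsilon> / 2)) / (- ln \<epsilon>)) \<longlongrightarrow> r) (at_right 0)"
      by real_asymp
    ultimately show ?thesis
      unfolding real by (rule Limsup_le_of_tendsto) simp
  qed (use c in auto)
qed

theorem theorem1:
  fixes g :: "'y::metric_space \<Rightarrow> 'x::metric_space \<Rightarrow> 'x"
    and P :: "(nat \<Rightarrow> 'y) measure"
  assumes "compact (UNIV :: 'x set)"
    and "compact (UNIV :: 'y set)"
    and "\<And>y. continuous_on UNIV (g y)"
    and "continuous_on UNIV (skew_product g)"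
    and "minimal_generators (range g)"
    and "prob_space P"
    and "sets P = sets borel"
  shows "upper_metric_mean_dimension g P =
           Limsup (at_right 0) (\<lambda>\<epsilon>. (SUP x. local_entropy g P x \<epsilon>) / ereal (- ln \<epsilon>))"
  \<comment> \<open>With the supremum evaluated at each scale, it remains to compare separation and
    covering numbers of the whole space.\<close>
  unfolding upper_metric_mean_dimension_def SUP_local_entropy[OF assms(1,4,7)]
proof (rule antisym)
  show "Limsup (at_right 0) (\<lambda>\<epsilon>. entropy_scale g P \<epsilon> / ereal (- ln \<epsilon>))
          \<le> Limsup (at_right 0) (\<lambda>\<epsilon>. covering_entropy g P UNIV \<epsilon> / ereal (- ln \<epsilon>))"
    unfolding entropy_scale_def covering_entropy_def
    by (intro Limsup_scale_divide_ln_le growth_rate_mono separation_number_le_covering_number)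
  have "eventually (\<lambda>\<epsilon>::real. \<epsilon> \<in> {0<..<1}) (at_right 0)"
    by (rule eventually_at_right_real) simp
  then show "Limsup (at_right 0) (\<lambda>\<epsilon>. covering_entropy g P UNIV \<epsilon> / ereal (- ln \<epsilon>))
          \<le> Limsup (at_right 0) (\<lambda>\<epsilon>. entropy_scale g P \<epsilon> / ereal (- ln \<epsilon>))"
    unfolding entropy_scale_def covering_entropy_def
    by (intro Limsup_mono, eventually_elim)
      (auto intro!: ereal_divide_right_mono growth_rate_mono covering_number_le_separation_number)
qed

end
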